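(* Let $\mathsf G=(\mathsf V,m,b,c)$ be a connected finite graph with standard edge weights $b\in\{0,1\}$, $m\equiv 1$ and $c\equiv 0$, and let $\emptyset\ne\mathsf V_0\subsetneq\mathsf V$. Then $$T_2(\mathsf G;\mathsf V_0)^{\frac23}\,\lambda_{0,2}(\mathsf G;\mathsf V_0)\ \ge\ \frac{\min_{\mathsf v\in\mathsf V\setminus\mathsf V_0}\deg_{\mathsf G}(\mathsf v)}{\big(\max_{\mathsf v\in\mathsf V\setminus\mathsf V_0}\deg_{\mathsf G}(\mathsf v)\big)^{\frac43}},$$ and equality holds if $\mathsf G$ is a path graph on a single edge with one Dirichlet condition (i.e. $\mathsf V$ consists of two adjacent vertices and $\mathsf V_0$ of one of them).
   Context: A finite graph $\mathsf G=(\mathsf V,m,b,c)$ consists of a finite set $\mathsf V$, a weight $m:\mathsf V\to(0,\infty)$, a symmetric function $b:\mathsf V\times\mathsf V\to[0,\infty)$ with $b(\mathsf v,\mathsf v)=0$, and $c:\mathsf V\to[0,\infty)$. Connected: any two vertices are joined by a sequence of vertices whose consecutive members have $b>0$. For $c\equiv0$, $\deg_{\mathsf G}(\mathsf v)=\sum_{\mathsf w\in\mathsf V}b(\mathsf v,\mathsf w)$. With $c\equiv0$ and Dirichlet conditions at $\mathsf V_0$, define (over $0\ne u:\mathsf V\to\mathbb R$ with $u=0$ on $\mathsf V_0$) $$T_2(\mathsf G;\mathsf V_0)=\sup_u\frac{\big(\sum_{\mathsf v}|u(\mathsf v)|m(\mathsf v)\big)^2}{\frac12\sum_{\mathsf v,\mathsf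 w}b(\mathsf v,\mathsf w)|u(\mathsf v)-u(\mathsf w)|^2},\qquad \lambda_{0,2}(\mathsf G;\mathsf V_0)=\inf_u\frac{\frac12\sum_{\mathsf v,\mathsf w}b(\mathsf v,\mathsf w)|u(\mathsf v)-u(\mathsf w)|^2}{\sum_{\mathsf v}|u(\mathsf v)|^2m(\mathsf v)}.$$ *)

theory Defs
  imports Complex_Main
begin

text \<open>
  The maps \<open>m\<close>, \<open>b\<close>, \<open>c\<close> of a graph, and the test functions \<open>u\<close>, are total HOL functions;
  only their values on the vertex set are ever constrained or used.
\<close>

record 'v wgraph =
  verts :: "'v set"
  vweight :: "'v \<Rightarrow> real"
  eweight :: "'v \<Rightarrow> 'v \<Rightarrow> real"
  potential :: "'v \<Rightarrow> real"

definition finite_graph :: "'v wgraph \<Rightarrow> bool" where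
  "finite_graph G \<longleftrightarrow>
     finite (verts G) \<and>
     (\<forall>v\<in>verts G. vweight G v > 0) \<and>
     (\<forall>v\<in>verts G. \<forall>w\<in>verts G. eweight G v w \<ge> 0 \<and> eweight G v w = eweight G w v) \<and>
     (\<forall>v\<in>verts G. eweight G v v = 0) \<and>
     (\<forall>v\<in>verts G. potential G v \<ge> 0)"

definition connected_graph :: "'v wgraph \<Rightarrow> bool" where
  "connected_graph G \<longleftrightarrow>
     (\<forall>v\<in>verts G. \<forall>w\<in>verts G. \<exists>xs. xs \<noteq> [] \<and> set xs \<subseteq> verts G \<and> hd xs = v \<and> last xs = w \<and>
        successively (\<lambda>x y. eweight G x y > 0) xs)"

text \<open>The degree, the energy and the quantities built from it are those for vanishing potential.\<close>

definition deg :: "'v wgraph \<Rightarrow> 'v \<Rightarrow> real" where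
  "deg G v = (\<Sum>w\<in>verts G. eweight G v w)"

definition energy :: "'v wgraph \<Rightarrow> ('v \<Rightarrow> real) \<Rightarrow> real" where
  "energy G u = 1/2 * (\<Sum>v\<in>verts G. \<Sum>w\<in>verts G. eweight G v w * \<bar>u v - u w\<bar>\<^sup>2)"

definition test_functions :: "'v wgraph \<Rightarrow> 'v set \<Rightarrow> ('v \<Rightarrow> real) set" where
  "test_functions G V0 = {u. (\<exists>v\<in>verts G. u v \<noteq> 0) \<and> (\<forall>v\<in>V0. u v = 0)}"

text \<open>
  Supremum and infimum are taken in the reals. For a connected finite graph and a nonempty
  proper subset \<open>V0\<close> of the vertices, the set of test functions is nonempty, the energy is
  positive on it, and both quotients are bounded.
\<close>

definition torsional_rigidity :: "'v wgraph \<Rightarrow> 'v set \<Rightarrow> real" where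
  "torsional_rigidity G V0 =
     (SUP u\<in>test_functions G V0. (\<Sum>v\<in>verts G. \<bar>u v\<bar> * vweight G v)\<^sup>2 / energy G u)"

definition ground_state_energy :: "'v wgraph \<Rightarrow> 'v set \<Rightarrow> real" where
  "ground_state_energy G V0 =
     (INF u\<in>test_functions G V0. energy G u / (\<Sum>v\<in>verts G. \<bar>u v\<bar>\<^sup>2 * vweight G v))"

end

theory Submission
  imports Defs "HOL-Analysis.Convex"
begin

text \<open>
  Write \<open>S1\<close>, \<open>S2\<close> and \<open>E\<close> for the mass, the squared norm and the energy of a nonnegative test
  function \<open>u\<close> with maximum \<open>M\<close>. Using \<open>u\<close> itself as a competitor for the torsional rigidity
  reduces the theorem to \<open>d ^ 3 * S2 ^ 3 \<le> D ^ 4 * (S1 ^ 4 * E)\<close>, where \<open>d\<close> and \<open>D\<close> are the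
  extremal degrees, so no minimiser is needed. As \<open>S2 \<le> M * S1\<close>, it suffices to bound \<open>M\<close>.
  Telescoping \<open>u powr (3/2)\<close> along a path from the maximum to the Dirichlet set gives
  \<open>M ^ 3 \<le> 9/4 * E * S1\<close>, which is enough whenever \<open>d ^ 3 / D ^ 4 \<le> 4/9\<close>. Since degrees are
  positive integers, only \<open>d = D = 1\<close> and \<open>d = D = 2\<close> remain. In the first case every free
  vertex hangs on a Dirichlet vertex, so \<open>E \<ge> S2\<close>. In the second, by parity every set of free
  vertices has at least two boundary edges, and a coarea argument for \<open>u\<^sup>2\<close> gives
  \<open>M ^ 4 \<le> E * S2\<close>.
\<close>

section \<open>Loop erasure and elementary inequalities\<close>

text \<open>Loop erasure: if the new head already occurs in the shortened walk, the part before that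
  occurrence is skipped. A simple path uses each vertex and edge at most once, so its energy and
  mass do not exceed those of the graph.\<close>

lemma distinct_walk:
  assumes "xs \<noteq> []" "successively P xs"
  shows "\<exists>ys. ys \<noteq> [] \<and> distinct ys \<and> successively P ys \<and> set ys \<subseteq> set xs
           \<and> hd ys = hd xs \<and> last ys = last xs"
  using assms
proof (induction xs)
  case Nil
  then show ?case by simp
next
  case (Cons x xs)
  show ?case
  proof (cases "xs = []")
    case True
    then show ?thesis by (intro exI[of _ "[x]"]) simp
  next
    case False
    with Cons.prems have "successively P xs" and Px: "P x (hd xs)"
      by (auto simp: successively_Cons)
    with Cons.IH False obtain ys where ys: "ys \<noteq> []" "distinct ys" "successively P ys"
      "set ys \<subseteq> set xs" "hd ys = hd xs" "last ys = last xs"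
      by blast
    show ?thesis
    proof (cases "x \<in> set ys")
      case True
      then obtain as bs where "ys = as @ x # bs" by (auto dest: split_list)
      with ys False show ?thesis
        by (intro exI[of _ "x # bs"]) (auto simp: successively_append_iff)
    next
      case False
      with ys Px \<open>xs \<noteq> []\<close> show ?thesis
        by (intro exI[of _ "x # ys"]) (auto simp: successively_Cons)
    qed
  qed
qed

text \<open>Two-term Cauchy-Schwarz without square roots, so that it can be iterated along a path:
  by the arithmetic-geometric mean inequality \<open>2 * (A * B)\<close> is at most
  \<open>P1 * Q2 + P2 * Q1\<close>.\<close>

lemma Cauchy_Schwarz_step:
  fixes A B P1 P2 Q1 Q2 :: real
  assumes "A\<^sup>2 \<le> P1 * Q1" "B\<^sup>2 \<le> P2 * Q2" "P1 \<ge> 0" "P2 \<ge> 0" "Q1 \<ge> 0" "Q2 \<ge> 0"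
  shows "(A + B)\<^sup>2 \<le> (P1 + P2) * (Q1 + Q2)"
proof -
  have "(A * B)\<^sup>2 \<le> (P1 * Q1) * (P2 * Q2)"
    unfolding power_mult_distrib using assms by (intro mult_mono) auto
  also have "\<dots> = (P1 * Q2) * (P2 * Q1)" by simp
  also have "4 * \<dots> \<le> (P1 * Q2 + P2 * Q1)\<^sup>2"
    using sum_squares_bound[of "P1 * Q2" "P2 * Q1"] by (simp add: power2_eq_square algebra_simps)
  finally have "(2 * (A * B))\<^sup>2 \<le> (P1 * Q2 + P2 * Q1)\<^sup>2"
    by (simp add: power_mult_distrib)
  then have "2 * (A * B) \<le> P1 * Q2 + P2 * Q1"
    by (rule power2_le_imp_le) (use assms in auto)
  with assms(1,2) show ?thesis by (simp add: power2_sum distrib_left distrib_right)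
qed

text \<open>With \<open>p\<close> and \<open>q\<close> the square roots of two values of
  \<open>u\<close>, this is the discrete form of \<open>(u^(3/2))'^2 = 9/4 * u * u'^2\<close>. The
  mean of the two values replaces \<open>u\<close>, hence 9/8, which is sharp as \<open>q\<close>
  tends to \<open>p\<close>.\<close>

lemma cube_diff_bound:
  fixes p q :: real
  assumes "p \<ge> 0" "q \<ge> 0"
  shows "(p ^ 3 - q ^ 3)\<^sup>2 \<le> (p\<^sup>2 - q\<^sup>2)\<^sup>2 * (9/8 * (p\<^sup>2 + q\<^sup>2))"
proof -
  have "9/8 * ((p + q)\<^sup>2 * (p\<^sup>2 + q\<^sup>2)) - (p\<^sup>2 + p * q + q\<^sup>2)\<^sup>2
      = 1/8 * ((p - q)\<^sup>2 * ((p + q)\<^sup>2 + 2 * (p * q)))"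
    by algebra
  also have "\<dots> \<ge> 0" using assms by simp
  finally have "(p\<^sup>2 + p * q + q\<^sup>2)\<^sup>2 \<le> 9/8 * ((p + q)\<^sup>2 * (p\<^sup>2 + q\<^sup>2))" by simp
  then have "(p - q)\<^sup>2 * (p\<^sup>2 + p * q + q\<^sup>2)\<^sup>2 \<le> (p - q)\<^sup>2 * (9/8 * ((p + q)\<^sup>2 * (p\<^sup>2 + q\<^sup>2)))"
    by (intro mult_left_mono) auto
  moreover have "(p ^ 3 - q ^ 3)\<^sup>2 = (p - q)\<^sup>2 * (p\<^sup>2 + p * q + q\<^sup>2)\<^sup>2" by algebra
  moreover have "(p\<^sup>2 - q\<^sup>2)\<^sup>2 * (9/8 * (p\<^sup>2 + q\<^sup>2)) = (p - q)\<^sup>2 * (9/8 * ((p + q)\<^sup>2 * (p\<^sup>2 + q\<^sup>2)))"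
    by algebra
  ultimately show ?thesis by simp
qed

lemma double_sum_insert:
  fixes F :: "'a \<Rightarrow> 'a \<Rightarrow> real"
  assumes "finite W" "x \<notin> W" "F x x = 0" "\<And>v. v \<in> W \<Longrightarrow> F v x = F x v"
  shows "(\<Sum>v\<in>insert x W. \<Sum>w\<in>insert x W. F v w) = (\<Sum>v\<in>W. \<Sum>w\<in>W. F v w) + 2 * (\<Sum>w\<in>W. F x w)"
proof -
  have "(\<Sum>v\<in>W. F v x) = (\<Sum>w\<in>W. F x w)" using assms by (intro sum.cong) auto
  with assms show ?thesis by (simp add: sum.distrib)
qed

section \<open>Energy on vertex sets and the maximum of a function\<close>

locale dirichlet_graph =
  fixes V V0 :: "'v set" and b :: "'v \<Rightarrow> 'v \<Rightarrow> real"
  assumes fin: "finite V"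
    and b01: "\<And>v w. v \<in> V \<Longrightarrow> w \<in> V \<Longrightarrow> b v w = 0 \<or> b v w = 1"
    and sym: "\<And>v w. v \<in> V \<Longrightarrow> w \<in> V \<Longrightarrow> b v w = b w v"
    and irrefl: "\<And>v. v \<in> V \<Longrightarrow> b v v = 0"
    and walk: "\<And>v w. v \<in> V \<Longrightarrow> w \<in> V \<Longrightarrow> \<exists>xs. xs \<noteq> [] \<and> set xs \<subseteq> V \<and> hd xs = v \<and> last xs = w \<and>
        successively (\<lambda>x y. b x y > 0) xs"
    and V0_nonempty: "V0 \<noteq> {}"
    and V0_proper: "V0 \<subset> V"
begin

text \<open>Only edges inside \<open>W\<close> count, so that the energy can be followed while a
  path grows vertex by vertex.\<close>

definition en :: "'v set \<Rightarrow> ('v \<Rightarrow> real) \<Rightarrow> real" where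
  "en W u = 1/2 * (\<Sum>v\<in>W. \<Sum>w\<in>W. b v w * (u v - u w)\<^sup>2)"

definition degree :: "'v \<Rightarrow> real" where
  "degree v = (\<Sum>w\<in>V. b v w)"

lemma b_nonneg: "v \<in> V \<Longrightarrow> w \<in> V \<Longrightarrow> b v w \<ge> 0"
  using b01[of v w] by auto

lemma en_nonneg: "W \<subseteq> V \<Longrightarrow> en W u \<ge> 0"
  unfolding en_def by (auto intro!: sum_nonneg mult_nonneg_nonneg b_nonneg)

lemma en_mono:
  assumes "W \<subseteq> V" shows "en W u \<le> en V u"
proof -
  have "(\<Sum>v\<in>W. \<Sum>w\<in>W. b v w * (u v - u w)\<^sup>2) \<le> (\<Sum>v\<in>W. \<Sum>w\<in>V. b v w * (u v - u w)\<^sup>2)"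
    using assms fin by (intro sum_mono sum_mono2) (auto intro!: mult_nonneg_nonneg b_nonneg)
  also have "\<dots> \<le> (\<Sum>v\<in>V. \<Sum>w\<in>V. b v w * (u v - u w)\<^sup>2)"
    using assms fin by (intro sum_mono2) (auto intro!: sum_nonneg mult_nonneg_nonneg b_nonneg)
  finally show ?thesis unfolding en_def by simp
qed

text \<open>The edge to \<open>y\<close> has weight 1, and the other edges from \<open>x\<close>
  into \<open>W\<close> only add energy.\<close>

lemma en_insert:
  assumes "W \<subseteq> V" "x \<in> V" "x \<notin> W" "y \<in> W" "b x y > 0"
  shows "en W u + (u x - u y)\<^sup>2 \<le> en (insert x W) u"
proof -
  have finW: "finite W" using assms fin finite_subset by blast
  have b1: "b x y = 1" using assms b01[of x y] by auto
  have "(u x - u y)\<^sup>2 = b x y * (u x - u y)\<^sup>2" by (simp add: b1)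
  also have "\<dots> \<le> (\<Sum>w\<in>W. b x w * (u x - u w)\<^sup>2)"
    using assms finW by (intro member_le_sum) (auto intro!: mult_nonneg_nonneg b_nonneg)
  also have "en W u + \<dots> = en (insert x W) u"
    unfolding en_def using assms finW
    by (subst double_sum_insert) (auto simp: irrefl sym power2_commute algebra_simps)
  finally show ?thesis by simp
qed

text \<open>
  The integrand \<open>sqrt u * u'\<close> is split by Cauchy--Schwarz into energy and mass. Summing
  \<open>u x + u y\<close> over the edges of the path counts each vertex twice except the endpoints.
\<close>

lemma path_bound:
  assumes "xs \<noteq> []" "distinct xs" "set xs \<subseteq> V" "successively (\<lambda>x y. b x y > 0) xs"
    and "u (last xs) = 0" "\<And>v. v \<in> V \<Longrightarrow> u v \<ge> 0"
  shows "u (hd xs) ^ 3 \<le> en (set xs) u * (9/8 * (2 * (\<Sum>v\<in>set xs. u v) - u (hd xs)))"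
  using assms(1-5)
proof (induction xs)
  case Nil
  then show ?case by simp
next
  case (Cons x xs)
  show ?case
  proof (cases "xs = []")
    case True
    with Cons.prems show ?thesis by simp
  next
    case False
    define y where "y = hd xs"
    have y: "y \<in> set xs" "b x y > 0" using Cons.prems False by (auto simp: y_def successively_Cons)
    have xV: "x \<in> V" "set xs \<subseteq> V" "x \<notin> set xs" "y \<in> V" using Cons.prems y by auto
    have nn: "u x \<ge> 0" "u y \<ge> 0" using assms(6) xV by auto
    have IH: "u y ^ 3 \<le> en (set xs) u * (9/8 * (2 * (\<Sum>v\<in>set xs. u v) - u y))"
      unfolding y_def using Cons False by (auto simp: successively_Cons)
    have uy: "u y \<le> (\<Sum>v\<in>set xs. u v)"
      using y xV assms(6) by (intro member_le_sum) auto
    have sq: "(sqrt (u v) ^ 3)\<^sup>2 = u v ^ 3" if "u v \<ge> 0" for v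
      using that by (metis power_even_eq power_mult real_sqrt_pow2 mult.commute)
    \<comment> \<open>Here \<open>sqrt t ^ 3\<close> is t to the power 3/2. The induction hypothesis
      controls the value at \<open>y\<close>, and \<open>cube_diff_bound\<close> the increment from
      \<open>y\<close> to \<open>x\<close>.\<close>
    have "(sqrt (u y) ^ 3 + (sqrt (u x) ^ 3 - sqrt (u y) ^ 3))\<^sup>2
        \<le> (en (set xs) u + (u x - u y)\<^sup>2)
          * (9/8 * (2 * (\<Sum>v\<in>set xs. u v) - u y) + 9/8 * (u x + u y))"
      using IH sq[OF nn(2)] cube_diff_bound[of "sqrt (u x)" "sqrt (u y)"] nn en_nonneg xV uy
      by (intro Cauchy_Schwarz_step) auto
    then have "u x ^ 3 \<le> (en (set xs) u + (u x - u y)\<^sup>2)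
          * (9/8 * (2 * (\<Sum>v\<in>set xs. u v) - u y) + 9/8 * (u x + u y))"
      using sq[OF nn(1)] by simp
    also have "\<dots> \<le> en (insert x (set xs)) u
          * (9/8 * (2 * (\<Sum>v\<in>set xs. u v) - u y) + 9/8 * (u x + u y))"
      using en_insert[of "set xs" x y u] xV y uy nn by (intro mult_right_mono) auto
    \<comment> \<open>The correction \<open>- u y\<close> cancels against the new edge, and the
      remaining \<open>+ u x\<close> is \<open>2 * u x - u x\<close>.\<close>
    also have "\<dots> = en (set (x # xs)) u * (9/8 * (2 * (\<Sum>v\<in>set (x # xs). u v) - u x))"
      using xV by (simp add: field_simps)
    finally show ?thesis by simp
  qed
qed

text \<open>A simple path from \<open>x\<close> to the Dirichlet set has at most the energy and mass
  of the whole graph. Dropping \<open>- u x\<close> in \<open>path_bound\<close> turns 9/8 into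
  9/4.\<close>

lemma sup_bound:
  assumes "\<And>v. v \<in> V \<Longrightarrow> u v \<ge> 0" "\<And>v. v \<in> V0 \<Longrightarrow> u v = 0" "x \<in> V"
  shows "u x ^ 3 \<le> 9/4 * en V u * (\<Sum>v\<in>V. u v)"
proof -
  obtain z where z: "z \<in> V0" "z \<in> V" using V0_nonempty V0_proper by blast
  obtain xs where "xs \<noteq> []" "set xs \<subseteq> V" "hd xs = x" "last xs = z"
    "successively (\<lambda>x y. b x y > 0) xs"
    using walk[OF assms(3) z(2)] by blast
  with distinct_walk[of xs "\<lambda>x y. b x y > 0"]
  obtain ys where ys: "ys \<noteq> []" "distinct ys" "set ys \<subseteq> V" "hd ys = x" "last ys = z"
    "successively (\<lambda>x y. b x y > 0) ys"
    by (metis subset_trans)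
  have "u x ^ 3 \<le> en (set ys) u * (9/8 * (2 * (\<Sum>v\<in>set ys. u v) - u x))"
    using path_bound[of ys u] ys assms z by auto
  also have "\<dots> \<le> en V u * (9/8 * (2 * (\<Sum>v\<in>V. u v)))"
  proof (rule mult_mono)
    have "(\<Sum>v\<in>set ys. u v) \<le> (\<Sum>v\<in>V. u v)"
      using fin ys assms by (intro sum_mono2) auto
    then show "9/8 * (2 * (\<Sum>v\<in>set ys. u v) - u x) \<le> 9/8 * (2 * (\<Sum>v\<in>V. u v))"
      using assms by simp (smt (verit))
    have "x \<in> set ys" using ys by auto
    then have "u x \<le> (\<Sum>v\<in>set ys. u v)" using ys assms by (intro member_le_sum) auto
    then show "0 \<le> 9/8 * (2 * (\<Sum>v\<in>set ys. u v) - u x)"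
      using assms(1)[OF assms(3)] by simp
  qed (use ys en_mono en_nonneg in auto)
  finally show ?thesis by (simp add: algebra_simps)
qed

section \<open>Consequences of the bound on the maximum\<close>

lemma square_sum_le:
  fixes u :: "'v \<Rightarrow> real"
  assumes "\<And>v. v \<in> V \<Longrightarrow> u v \<ge> 0" "\<And>v. v \<in> V \<Longrightarrow> u v \<le> M"
  shows "(\<Sum>v\<in>V. (u v)\<^sup>2) \<le> M * (\<Sum>v\<in>V. u v)"
proof -
  have "(\<Sum>v\<in>V. (u v)\<^sup>2) \<le> (\<Sum>v\<in>V. M * u v)"
    using assms by (intro sum_mono) (simp add: power2_eq_square mult_right_mono)
  then show ?thesis by (simp add: sum_distrib_left)
qed

lemma obtain_max:
  obtains x where "x \<in> V" "\<And>v. v \<in> V \<Longrightarrow> (u v :: real) \<le> u x"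
proof -
  have "V \<noteq> {}" using V0_proper by blast
  then have "Max (u ` V) \<in> u ` V" using fin by simp
  then obtain x where "x \<in> V" "Max (u ` V) = u x" by blast
  moreover have "u v \<le> Max (u ` V)" if "v \<in> V" for v using that fin by simp
  ultimately show ?thesis using that by metis
qed

lemma quartic_bound_general:
  assumes "\<And>v. v \<in> V \<Longrightarrow> u v \<ge> 0" "\<And>v. v \<in> V0 \<Longrightarrow> u v = 0"
  shows "4/9 * (\<Sum>v\<in>V. (u v)\<^sup>2) ^ 3 \<le> (\<Sum>v\<in>V. u v) ^ 4 * en V u"
proof -
  obtain x where x: "x \<in> V" "\<And>v. v \<in> V \<Longrightarrow> u v \<le> u x" by (rule obtain_max[of u]) blast
  have S1: "(\<Sum>v\<in>V. u v) \<ge> 0" using assms by (intro sum_nonneg)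
  have "(\<Sum>v\<in>V. (u v)\<^sup>2) ^ 3 \<le> (u x * (\<Sum>v\<in>V. u v)) ^ 3"
    using square_sum_le[of u "u x"] assms x by (intro power_mono sum_nonneg) auto
  also have "\<dots> = u x ^ 3 * (\<Sum>v\<in>V. u v) ^ 3" by (simp add: power_mult_distrib)
  also have "\<dots> \<le> (9/4 * en V u * (\<Sum>v\<in>V. u v)) * (\<Sum>v\<in>V. u v) ^ 3"
    using sup_bound[of u x] assms x S1 by (intro mult_right_mono) auto
  finally show ?thesis by (simp add: power_eq_if algebra_simps)
qed

text \<open>Bounds the quotients whose supremum is the torsional rigidity and forces positive energy
  on test functions. The crude constant comes from estimating the mass by \<open>card V\<close>
  times the maximum.\<close>

lemma mass_square_le_energy:
  assumes "\<And>v. v \<in> V \<Longrightarrow> u v \<ge> 0" "\<And>v. v \<in> V0 \<Longrightarrow> u v = 0"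
  shows "(\<Sum>v\<in>V. u v)\<^sup>2 \<le> 9/4 * card V ^ 3 * en V u"
proof -
  obtain x where x: "x \<in> V" "\<And>v. v \<in> V \<Longrightarrow> u v \<le> u x" by (rule obtain_max[of u]) blast
  have ux: "u x \<ge> 0" using x assms by auto
  have E: "en V u \<ge> 0" by (simp add: en_nonneg)
  have S: "(\<Sum>v\<in>V. u v) \<le> card V * u x" using x by (intro sum_bounded_above) auto
  have S0: "(\<Sum>v\<in>V. u v) \<ge> 0" using assms by (intro sum_nonneg)
  have "u x * (u x)\<^sup>2 \<le> u x * (9/4 * en V u * card V)"
  proof -
    have "u x * (u x)\<^sup>2 = u x ^ 3" by (simp add: power_eq_if)
    also have "\<dots> \<le> 9/4 * en V u * (\<Sum>v\<in>V. u v)"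
      using sup_bound[of u x] assms x by auto
    also have "\<dots> \<le> 9/4 * en V u * (card V * u x)"
      using S E by (intro mult_left_mono) auto
    finally show ?thesis by (simp add: algebra_simps)
  qed
  \<comment> \<open>One factor \<open>u x\<close> cancels; if it vanishes, only nonnegativity of the
    right side is claimed.\<close>
  then have *: "(u x)\<^sup>2 \<le> 9/4 * en V u * card V"
    using ux E by (cases "u x = 0") auto
  have "(\<Sum>v\<in>V. u v)\<^sup>2 \<le> (card V * u x)\<^sup>2" using S S0 by (intro power_mono)
  also have "\<dots> = (card V)\<^sup>2 * (u x)\<^sup>2" by (simp add: power_mult_distrib)
  also have "\<dots> \<le> (card V)\<^sup>2 * (9/4 * en V u * card V)"
    using * by (intro mult_left_mono) auto
  finally show ?thesis by (simp add: power_eq_if algebra_simps)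
qed

section \<open>Edge boundaries: connectedness, parity and coarea\<close>

definition cut :: "'v set \<Rightarrow> real" where
  "cut A = (\<Sum>v\<in>A. \<Sum>w\<in>V - A. b v w)"

text \<open>A walk from \<open>A\<close> to a Dirichlet vertex, which lies outside \<open>A\<close>,
  has to leave \<open>A\<close> at some step; a positive weight is 1.\<close>

lemma crossing_edge:
  assumes "A \<subseteq> V - V0" "A \<noteq> {}"
  shows "\<exists>v\<in>A. \<exists>w\<in>V - A. b v w = 1"
proof -
  have step: "\<exists>v\<in>A. \<exists>w\<in>V - A. b v w > 0"
    if "xs \<noteq> []" "set xs \<subseteq> V" "successively (\<lambda>x y. b x y > 0) xs" "hd xs \<in> A" "last xs \<notin> A" for xs
    using that
  proof (induction xs)
    case (Cons x xs)
    show ?case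
    proof (cases "xs = [] \<or> hd xs \<in> A")
      case True
      with Cons show ?thesis by (auto simp: successively_Cons split: if_splits)
    next
      case False
      then have "hd xs \<in> V" using Cons.prems by auto
      with False Cons.prems show ?thesis by (auto simp: successively_Cons)
    qed
  qed auto
  obtain x z where "x \<in> A" "z \<in> V0" using assms V0_nonempty by blast
  moreover from this have "x \<in> V" "z \<in> V" "z \<notin> A" using assms V0_proper by auto
  ultimately obtain v w where "v \<in> A" "w \<in> V - A" "b v w > 0"
    using walk[of x z] step by metis
  then show ?thesis using b01[of v w] assms by fastforce
qed

lemma cut_pos:
  assumes "A \<subseteq> V - V0" "A \<noteq> {}"
  shows "cut A > 0"
proof -
  obtain v w where vw: "v \<in> A" "w \<in> V - A" "b v w = 1" using crossing_edge[OF assms] by blast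
  have finA: "finite A" using assms fin by (meson finite_Diff finite_subset)
  have "0 < b v w" using vw by simp
  also have "\<dots> \<le> (\<Sum>w\<in>V - A. b v w)"
    using vw fin assms by (intro member_le_sum) (auto intro!: b_nonneg)
  also have "\<dots> \<le> cut A"
    unfolding cut_def using vw finA assms
    by (intro member_le_sum[where f = "\<lambda>v. \<Sum>w\<in>V - A. b v w"]) (auto intro!: b_nonneg sum_nonneg)
  finally show ?thesis .
qed

text \<open>Every inner edge is counted from both ends: a new vertex adds twice the number of its
  neighbours in \<open>A\<close>.\<close>

lemma inner_degree_even:
  assumes "finite A" "A \<subseteq> V"
  shows "\<exists>n::nat. (\<Sum>v\<in>A. \<Sum>w\<in>A. b v w) = 2 * real n"
  using assms
proof (induction A rule: finite_induct)
  case empty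
  then show ?case by simp
next
  case (insert x A)
  then obtain n :: nat where n: "(\<Sum>v\<in>A. \<Sum>w\<in>A. b v w) = 2 * real n" by auto
  have "(\<Sum>w\<in>A. b x w) = (\<Sum>w\<in>A. real (if b x w = 1 then 1 else 0))"
    using insert.prems b01 by (intro sum.cong) fastforce+
  then have "(\<Sum>w\<in>A. b x w) = real (\<Sum>w\<in>A. if b x w = 1 then 1 else 0)" by simp
  then obtain k :: nat where k: "(\<Sum>w\<in>A. b x w) = k" by blast
  have "(\<Sum>v\<in>insert x A. \<Sum>w\<in>insert x A. b v w) = 2 * real n + 2 * real k"
    using insert n k by (subst double_sum_insert) (auto simp: irrefl sym)
  also have "\<dots> = 2 * real (n + k)" by simp
  finally show ?case by blast
qed

text \<open>Handshake parity: a set of vertices of degree two has an even number of boundary edges.\<close>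

lemma cut_ge_2:
  assumes "A \<subseteq> V - V0" "A \<noteq> {}" "\<And>v. v \<in> V - V0 \<Longrightarrow> degree v = 2"
  shows "cut A \<ge> 2"
proof -
  have finA: "finite A" using assms fin by (meson finite_Diff finite_subset)
  have AV: "A \<subseteq> V" using assms by auto
  obtain n :: nat where n: "(\<Sum>v\<in>A. \<Sum>w\<in>A. b v w) = 2 * real n"
    using inner_degree_even[OF finA AV] by blast
  \<comment> \<open>The degree sum splits into edges leaving \<open>A\<close> and edges inside
    \<open>A\<close>, the latter an even contribution.\<close>
  have "cut A + (\<Sum>v\<in>A. \<Sum>w\<in>A. b v w) = (\<Sum>v\<in>A. degree v)"
    unfolding cut_def degree_def sum.distrib[symmetric]
    using AV fin by (simp add: sum.subset_diff[OF AV fin, of "b _"])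
  also have "\<dots> = (\<Sum>v\<in>A. 2)" using assms by (intro sum.cong) auto
  finally have "cut A = 2 * real (card A) - 2 * real n" using n by simp
  \<comment> \<open>Connectedness makes the even number \<open>cut A\<close> positive, so it is at
    least 2.\<close>
  moreover from this have "n < card A" using cut_pos[OF assms(1,2)] by simp
  then have "real n + 1 \<le> real (card A)" by linarith
  ultimately show ?thesis by simp
qed

text \<open>Only boundary edges contribute, and each occurs in both orders. This gives the variation
  of one level in the coarea argument.\<close>

lemma indicator_variation:
  assumes "A \<subseteq> V"
  shows "(\<Sum>v\<in>V. \<Sum>w\<in>V. b v w * \<bar>of_bool (v \<in> A) - of_bool (w \<in> A)\<bar>) = 2 * cut A"
proof -
  have "(\<Sum>v\<in>V. \<Sum>w\<in>V. b v w * \<bar>of_bool (v \<in> A) - of_bool (w \<in> A)\<bar>)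
      = (\<Sum>v\<in>V. \<Sum>w\<in>V. of_bool (v \<in> A) * (of_bool (w \<in> V - A) * b v w))
        + (\<Sum>v\<in>V. \<Sum>w\<in>V. of_bool (w \<in> A) * (of_bool (v \<in> V - A) * b v w))"
    unfolding sum.distrib[symmetric] by (intro sum.cong) auto
  also have "(\<Sum>v\<in>V. \<Sum>w\<in>V. of_bool (w \<in> A) * (of_bool (v \<in> V - A) * b v w))
      = (\<Sum>v\<in>V. \<Sum>w\<in>V. of_bool (v \<in> A) * (of_bool (w \<in> V - A) * b v w))"
    by (subst sum.swap) (auto intro!: sum.cong simp: sym)
  also have "\<dots> = (\<Sum>v\<in>V. of_bool (v \<in> A) * (\<Sum>w\<in>V. of_bool (w \<in> V - A) * b v w))"
    by (simp add: sum_distrib_left)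
  also have "\<dots> = (\<Sum>v\<in>V \<inter> A. \<Sum>w\<in>V \<inter> (V - A). b v w)"
    using fin by (simp add: sum.inter_restrict of_bool_def if_distrib[of "\<lambda>x. x * _"] cong: if_cong)
  also have "\<dots> = cut A"
    unfolding cut_def using assms by (intro sum.cong) auto
  finally show ?thesis by simp
qed

text \<open>A discrete coarea inequality, obtained by peeling off the lowest positive level.\<close>

lemma coarea:
  assumes "\<And>v. v \<in> V \<Longrightarrow> f v \<ge> 0" "\<And>v. v \<in> V0 \<Longrightarrow> f v = 0" "x \<in> V"
    and k: "\<And>A. A \<subseteq> V - V0 \<Longrightarrow> A \<noteq> {} \<Longrightarrow> k \<le> cut A"
  shows "2 * k * f x \<le> (\<Sum>v\<in>V. \<Sum>w\<in>V. b v w * \<bar>f v - f w\<bar>)"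
  using assms(1,2)
proof (induction "card {v\<in>V. f v > 0}" arbitrary: f rule: less_induct)
  case less
  define A where "A = {v\<in>V. f v > 0}"
  have finA: "finite A" using fin by (simp add: A_def)
  have off: "f v = 0" if "v \<in> V" "v \<notin> A" for v
    using that less.prems(1)[of v] by (auto simp: A_def)
  show ?case
  proof (cases "x \<in> A")
    case False
    then have "f x = 0" using assms(3) off by blast
    then show ?thesis by (auto intro!: sum_nonneg mult_nonneg_nonneg b_nonneg)
  next
    case True
    define s where "s = Min (f ` A)"
    \<comment> \<open>Lowering \<open>f\<close> by its least positive value on its support removes
      the minimiser \<open>a\<close> from the support, so the induction measure drops.\<close>
    define g where "g = (\<lambda>v. f v - s * of_bool (v \<in> A))"
    have s_le: "s \<le> f v" if "v \<in> A" for v using that finA by (simp add: s_def)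
    have "s \<in> f ` A" using True finA by (auto simp: s_def intro!: Min_in)
    then obtain a where a: "a \<in> A" "f a = s" by blast
    have s0: "s > 0" using a by (auto simp: A_def)
    have AV: "A \<subseteq> V" by (auto simp: A_def)
    have AV0: "A \<subseteq> V - V0" using less.prems(2) by (auto simp: A_def)
    have g0: "g v \<ge> 0" if "v \<in> V" for v
      using that s_le[of v] less.prems(1)[of v] by (auto simp: g_def)
    have "{v\<in>V. g v > 0} \<subseteq> A - {a}" using off a by (auto simp: g_def) force
    then have "card {v\<in>V. g v > 0} < card A"
      using a finA by (meson card_Diff1_less card_mono finite_Diff le_less_trans)
    then have IH: "2 * k * g x \<le> (\<Sum>v\<in>V. \<Sum>w\<in>V. b v w * \<bar>g v - g w\<bar>)"
      using less.prems AV0 g0 by (intro less.hyps) (auto simp: A_def g_def)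
    \<comment> \<open>No cancellation occurs: across the boundary of \<open>A\<close> the value of
      \<open>g\<close> outside is 0 and inside nonnegative, and elsewhere the indicator does not
      change.\<close>
    have "\<bar>f v - f w\<bar> = \<bar>g v - g w\<bar> + s * \<bar>of_bool (v \<in> A) - of_bool (w \<in> A)\<bar>"
      if "v \<in> V" "w \<in> V" for v w
      using that s_le[of v] s_le[of w] off[of v] off[of w] s0 by (auto simp: g_def)
    then have "(\<Sum>v\<in>V. \<Sum>w\<in>V. b v w * \<bar>f v - f w\<bar>)
      = (\<Sum>v\<in>V. \<Sum>w\<in>V. b v w * \<bar>g v - g w\<bar>
          + s * (b v w * \<bar>of_bool (v \<in> A) - of_bool (w \<in> A)\<bar>))"
      by (intro sum.cong) (auto simp: algebra_simps)
    also have "\<dots> = (\<Sum>v\<in>V. \<Sum>w\<in>V. b v w * \<bar>g v - g w\<bar>) + s * (2 * cut A)"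
      unfolding indicator_variation[OF AV, symmetric] by (simp only: sum.distrib sum_distrib_left)
    also have "\<dots> \<ge> 2 * k * g x + s * (2 * k)"
      using IH k[OF AV0] True s0 by (intro add_mono mult_left_mono) auto
    also have "2 * k * g x + s * (2 * k) = 2 * k * f x"
      using True by (simp add: g_def algebra_simps)
    finally show ?thesis .
  qed
qed

section \<open>Free degrees all equal to 2, or all equal to 1\<close>

lemma quartic_bound_degree_2:
  assumes "\<And>v. v \<in> V \<Longrightarrow> u v \<ge> 0" "\<And>v. v \<in> V0 \<Longrightarrow> u v = 0"
    and deg2: "\<And>v. v \<in> V - V0 \<Longrightarrow> degree v = 2"
  shows "(\<Sum>v\<in>V. (u v)\<^sup>2) ^ 3 \<le> (\<Sum>v\<in>V. u v) ^ 4 * en V u"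
proof -
  obtain x where x: "x \<in> V" "\<And>v. v \<in> V \<Longrightarrow> u v \<le> u x" by (rule obtain_max[of u]) blast
  define S1 S2 E where "S1 = (\<Sum>v\<in>V. u v)" and "S2 = (\<Sum>v\<in>V. (u v)\<^sup>2)" and "E = en V u"
  have nn: "S1 \<ge> 0" "S2 \<ge> 0" "E \<ge> 0"
    using assms by (auto simp: S1_def S2_def E_def sum_nonneg en_nonneg)
  have bb: "b v w * b v w = b v w" if "v \<in> V" "w \<in> V" for v w using b01[OF that] by auto
  have "4 * (u x)\<^sup>2 \<le> (\<Sum>v\<in>V. \<Sum>w\<in>V. b v w * \<bar>(u v)\<^sup>2 - (u w)\<^sup>2\<bar>)"
    using coarea[of "\<lambda>v. (u v)\<^sup>2" x 2] cut_ge_2 assms x by auto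
  \<comment> \<open>Since \<open>b\<close> is 0 or 1, it equals its square, and each Cauchy-Schwarz
    factor receives one copy.\<close>
  also have "\<dots> = (\<Sum>v\<in>V. \<Sum>w\<in>V. (b v w * \<bar>u v - u w\<bar>) * (b v w * (u v + u w)))"
  proof (intro sum.cong refl)
    fix v w assume vw: "v \<in> V" "w \<in> V"
    then have "\<bar>(u v)\<^sup>2 - (u w)\<^sup>2\<bar> = \<bar>u v - u w\<bar> * (u v + u w)"
      using assms(1) by (simp add: square_diff_square_factored power2_eq_square abs_mult)
    then show "b v w * \<bar>(u v)\<^sup>2 - (u w)\<^sup>2\<bar> = (b v w * \<bar>u v - u w\<bar>) * (b v w * (u v + u w))"
      using b01[OF vw] by auto
  qed
  finally have "(4 * (u x)\<^sup>2)\<^sup>2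
     \<le> (\<Sum>v\<in>V. \<Sum>w\<in>V. (b v w * \<bar>u v - u w\<bar>) * (b v w * (u v + u w)))\<^sup>2"
    by (intro power_mono) auto
  also have "\<dots> \<le> (\<Sum>v\<in>V. \<Sum>w\<in>V. (b v w * \<bar>u v - u w\<bar>)\<^sup>2) * (\<Sum>v\<in>V. \<Sum>w\<in>V. (b v w * (u v + u w))\<^sup>2)"
    using Cauchy_Schwarz_ineq_sum[of "\<lambda>(v, w). b v w * \<bar>u v - u w\<bar>" "\<lambda>(v, w). b v w * (u v + u w)" "V \<times> V"]
    by (simp add: sum.cartesian_product split_def)
  also have "(\<Sum>v\<in>V. \<Sum>w\<in>V. (b v w * \<bar>u v - u w\<bar>)\<^sup>2) = 2 * E"
    unfolding E_def en_def using bb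
    by (auto intro!: sum.cong simp: power_mult_distrib power2_eq_square[of "b _ _"])
  also have "(\<Sum>v\<in>V. \<Sum>w\<in>V. (b v w * (u v + u w))\<^sup>2)
      \<le> (\<Sum>v\<in>V. \<Sum>w\<in>V. 2 * (b v w * (u v)\<^sup>2) + 2 * (b v w * (u w)\<^sup>2))"
  proof (intro sum_mono)
    fix v w assume vw: "v \<in> V" "w \<in> V"
    have "(u v + u w)\<^sup>2 \<le> 2 * (u v)\<^sup>2 + 2 * (u w)\<^sup>2"
      using sum_squares_bound[of "u v" "u w"] by (simp add: power2_sum)
    then show "(b v w * (u v + u w))\<^sup>2 \<le> 2 * (b v w * (u v)\<^sup>2) + 2 * (b v w * (u w)\<^sup>2)"
      using b01[OF vw] by auto
  qed
  also have "\<dots> = 2 * (\<Sum>v\<in>V. \<Sum>w\<in>V. b v w * (u v)\<^sup>2) + 2 * (\<Sum>v\<in>V. \<Sum>w\<in>V. b v w * (u w)\<^sup>2)"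
    by (simp add: sum.distrib sum_distrib_left)
  also have "(\<Sum>v\<in>V. \<Sum>w\<in>V. b v w * (u w)\<^sup>2) = (\<Sum>v\<in>V. \<Sum>w\<in>V. b v w * (u v)\<^sup>2)"
    by (subst sum.swap) (auto intro!: sum.cong simp: sym)
  also have "(\<Sum>v\<in>V. \<Sum>w\<in>V. b v w * (u v)\<^sup>2) = (\<Sum>v\<in>V. degree v * (u v)\<^sup>2)"
    by (simp add: degree_def sum_distrib_right)
  \<comment> \<open>Degrees of Dirichlet vertices are unknown, but \<open>u\<close> vanishes
    there.\<close>
  also have "\<dots> = (\<Sum>v\<in>V. 2 * (u v)\<^sup>2)"
    using deg2 assms(2) by (intro sum.cong) auto
  also have "\<dots> = 2 * S2" by (simp add: S2_def sum_distrib_left)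
  \<comment> \<open>The constants balance exactly: 16 on the left, and \<open>2 * E\<close> times
    \<open>8 * S2\<close> on the right.\<close>
  finally have "(u x) ^ 4 \<le> E * S2"
    using nn by (simp add: mult_left_mono power_mult_distrib flip: power_mult)
  have "S2 * S2 ^ 3 = S2 ^ 4" by (simp add: power_eq_if)
  also have "\<dots> \<le> (u x * S1) ^ 4"
    using square_sum_le[of u "u x"] assms x nn by (intro power_mono) (auto simp: S1_def S2_def)
  also have "\<dots> \<le> (E * S2) * S1 ^ 4"
    unfolding power_mult_distrib using \<open>(u x) ^ 4 \<le> E * S2\<close> nn by (intro mult_right_mono) auto
  finally have "S2 * S2 ^ 3 \<le> S2 * (S1 ^ 4 * E)" by (simp add: algebra_simps)
  then have "S2 ^ 3 \<le> S1 ^ 4 * E"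
    using nn by (cases "S2 = 0") auto
  then show ?thesis by (simp add: S1_def S2_def E_def)
qed

text \<open>Since \<open>u\<close> vanishes on \<open>V0\<close>, an edge from a free vertex
  \<open>v\<close> into \<open>V0\<close> carries energy \<open>(u v)\<^sup>2\<close>. Hence
  \<open>S2 \<le> E\<close>, and \<open>S2 \<le> S1 * S1\<close> does the rest.\<close>

lemma quartic_bound_degree_1:
  assumes "\<And>v. v \<in> V \<Longrightarrow> u v \<ge> 0" "\<And>v. v \<in> V0 \<Longrightarrow> u v = 0"
    and deg1: "\<And>v. v \<in> V - V0 \<Longrightarrow> degree v = 1"
  shows "(\<Sum>v\<in>V. (u v)\<^sup>2) ^ 3 \<le> (\<Sum>v\<in>V. u v) ^ 4 * en V u"
proof -
  have unique: "w = w'" if "v \<in> V - V0" "w \<in> V" "w' \<in> V" "b v w = 1" "b v w' = 1" for v w w'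
  proof (rule ccontr)
    assume "w \<noteq> w'"
    then have "2 = (\<Sum>z\<in>{w, w'}. b v z)" using that by simp
    also have "\<dots> \<le> degree v" unfolding degree_def
      using that fin by (intro sum_mono2) (auto intro!: b_nonneg)
    finally show False using deg1[OF that(1)] by simp
  qed
  have nbr: "\<exists>w\<in>V0. b v w = 1" if v: "v \<in> V - V0" for v
  proof (rule ccontr)
    assume no: "\<not> (\<exists>w\<in>V0. b v w = 1)"
    obtain w where w: "w \<in> V - {v}" "b v w = 1" using crossing_edge[of "{v}"] v by auto
    then have wV0: "w \<in> V - V0" using no by auto
    \<comment> \<open>Two adjacent free vertices of degree 1 would have no further neighbour, yet
      some edge must leave the pair.\<close>
    then obtain a z where az: "a \<in> {v, w}" "z \<in> V - {v, w}" "b a z = 1"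
      using crossing_edge[of "{v, w}"] v by auto
    have "b w v = 1" using sym v w by auto
    then show False using az unique[of v z w] unique[of w z v] v w wV0 by auto
  qed
  define S1 S2 E where "S1 = (\<Sum>v\<in>V. u v)" and "S2 = (\<Sum>v\<in>V. (u v)\<^sup>2)" and "E = en V u"
  have nn: "S1 \<ge> 0" "S2 \<ge> 0" using assms by (auto simp: S1_def S2_def sum_nonneg)
  define F where "F = (\<lambda>v w. b v w * (u v - u w)\<^sup>2)"
  have F0: "F v w \<ge> 0" if "v \<in> V" "w \<in> V" for v w
    using that by (simp add: F_def b_nonneg)
  have Fs: "F v w = F w v" if "v \<in> V" "w \<in> V" for v w
    using that by (simp add: F_def sym power2_commute)
  have finV0: "finite V0" using fin V0_proper finite_subset by blast
  have VV: "V0 \<subseteq> V" using V0_proper by auto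
  have S2': "S2 = (\<Sum>v\<in>V - V0. (u v)\<^sup>2)"
    unfolding S2_def using fin assms(2) by (intro sum.mono_neutral_right) auto
  have "S2 \<le> (\<Sum>v\<in>V - V0. \<Sum>w\<in>V0. F v w)"
    unfolding S2'
  proof (rule sum_mono)
    fix v assume v: "v \<in> V - V0"
    obtain w where w: "w \<in> V0" "b v w = 1" using nbr[OF v] by blast
    then have "(u v)\<^sup>2 = F v w" using assms(2) by (simp add: F_def)
    also have "\<dots> \<le> (\<Sum>w\<in>V0. F v w)"
      using w finV0 v VV by (intro member_le_sum) (auto intro!: F0)
    finally show "(u v)\<^sup>2 \<le> (\<Sum>w\<in>V0. F v w)" .
  qed
  \<comment> \<open>Edges between free and Dirichlet vertices occur in both orders, which absorbs
    the factor 1/2 of the energy.\<close>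
  moreover have "(\<Sum>v\<in>V0. \<Sum>w\<in>V - V0. F v w) = (\<Sum>v\<in>V - V0. \<Sum>w\<in>V0. F v w)"
    using VV by (subst sum.swap) (auto intro!: sum.cong Fs)
  moreover have "(\<Sum>v\<in>V. \<Sum>w\<in>V. F v w) = (\<Sum>v\<in>V - V0. \<Sum>w\<in>V. F v w) + (\<Sum>v\<in>V0. \<Sum>w\<in>V. F v w)"
    using sum.subset_diff[OF VV fin] by simp
  moreover have "(\<Sum>v\<in>V - V0. \<Sum>w\<in>V0. F v w) \<le> (\<Sum>v\<in>V - V0. \<Sum>w\<in>V. F v w)"
    using VV fin by (intro sum_mono sum_mono2) (auto intro!: F0)
  moreover have "(\<Sum>v\<in>V0. \<Sum>w\<in>V - V0. F v w) \<le> (\<Sum>v\<in>V0. \<Sum>w\<in>V. F v w)"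
    using VV fin by (intro sum_mono sum_mono2) (auto intro!: F0)
  moreover have "E = 1/2 * (\<Sum>v\<in>V. \<Sum>w\<in>V. F v w)" by (simp add: E_def en_def F_def)
  ultimately have E: "S2 \<le> E" by linarith
  \<comment> \<open>The mass itself serves as upper bound for all values.\<close>
  have "S2 \<le> S1 * S1" unfolding S1_def S2_def
    using assms fin by (intro square_sum_le) (auto intro!: member_le_sum)
  then have "S2 * S2 * S2 \<le> (S1 * S1) * (S1 * S1) * E"
    using nn E by (intro mult_mono) auto
  then show ?thesis by (simp add: S1_def S2_def E_def power_eq_if algebra_simps)
qed

section \<open>Case distinction on the extremal degrees\<close>

lemma degree_nat: "v \<in> V \<Longrightarrow> \<exists>n::nat. degree v = n"
proof -
  assume v: "v \<in> V"
  have "degree v = (\<Sum>w\<in>V. real (if b v w = 1 then 1 else 0))"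
    unfolding degree_def using v b01 by (intro sum.cong) fastforce+
  also have "\<dots> = real (\<Sum>w\<in>V. if b v w = 1 then 1 else 0)" by simp
  finally show ?thesis by blast
qed

lemma degree_ge_1:
  assumes "v \<in> V - V0" shows "degree v \<ge> 1"
proof -
  obtain w where "w \<in> V" "b v w = 1" using crossing_edge[of "{v}"] assms by auto
  then show ?thesis
    unfolding degree_def using member_le_sum[of w V "b v"] assms fin b_nonneg by auto
qed

lemma quartic_bound:
  assumes "\<And>v. v \<in> V \<Longrightarrow> u v \<ge> 0" "\<And>v. v \<in> V0 \<Longrightarrow> u v = 0"
  shows "Min (degree ` (V - V0)) ^ 3 * (\<Sum>v\<in>V. (u v)\<^sup>2) ^ 3
    \<le> Max (degree ` (V - V0)) ^ 4 * ((\<Sum>v\<in>V. u v) ^ 4 * en V u)"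
proof -
  let ?D = "degree ` (V - V0)"
  have D: "finite ?D" "?D \<noteq> {}" using fin V0_proper by auto
  obtain x where x: "x \<in> V - V0" "Min ?D = degree x" using Min_in[OF D] by auto
  obtain y where y: "y \<in> V - V0" "Max ?D = degree y" using Max_in[OF D] by auto
  obtain d1 d2 :: nat where d: "Min ?D = d1" "Max ?D = d2"
    using degree_nat[of x] degree_nat[of y] x y by auto
  have d1: "d1 \<ge> 1" using degree_ge_1[OF x(1)] x(2) d(1) by simp
  have le: "d1 \<le> d2" using d Min_le[OF D(1)] Max_in[OF D] by (metis of_nat_le_iff)
  have range: "d1 \<le> degree v" "degree v \<le> d2" if "v \<in> V - V0" for v
    using that D d Min_le[OF D(1), of "degree v"] Max_ge[OF D(1), of "degree v"] by auto
  define Q R where "Q = (\<Sum>v\<in>V. u v) ^ 4 * en V u" and "R = (\<Sum>v\<in>V. (u v)\<^sup>2) ^ 3"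
  have nn: "Q \<ge> 0" "R \<ge> 0" by (auto simp: Q_def R_def sum_nonneg en_nonneg)
  have gen: "4/9 * R \<le> Q" unfolding Q_def R_def by (rule quartic_bound_general[OF assms])
  have "real d1 ^ 3 * R \<le> real d2 ^ 4 * Q"
  proof -
    \<comment> \<open>The ratio \<open>d1 ^ 3 / d2 ^ 4\<close> is 1/16 in the third case and at most
      1/3 in the fourth, both below 4/9.\<close>
    consider "d1 = 1" "d2 = 1" | "d1 = 2" "d2 = 2" | "d1 = 1" "d2 = 2" | "d2 \<ge> 3"
      using d1 le by linarith
    then show ?thesis
    proof cases
      case 1
      then have "\<And>v. v \<in> V - V0 \<Longrightarrow> degree v = 1" using range by force
      then show ?thesis using quartic_bound_degree_1[OF assms] 1 by (simp add: Q_def R_def)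
    next
      case 2
      then have "\<And>v. v \<in> V - V0 \<Longrightarrow> degree v = 2" using range by force
      then have "R \<le> Q" using quartic_bound_degree_2[OF assms] by (simp add: Q_def R_def)
      then show ?thesis using 2 nn by simp
    next
      case 3
      then show ?thesis using gen nn by simp
    next
      case 4
      have "real d1 ^ 3 * R \<le> real d2 ^ 3 * R"
        using le nn by (intro mult_right_mono power_mono) auto
      also have "\<dots> \<le> real d2 ^ 3 * (real d2 * Q)"
      proof (rule mult_left_mono)
        have "R \<le> 3 * Q" using gen nn by simp
        also have "\<dots> \<le> real d2 * Q" using 4 nn by (intro mult_right_mono) auto
        finally show "R \<le> real d2 * Q" .
      qed auto
      finally show ?thesis by (simp add: power_eq_if algebra_simps)
    qed
  qed
  then show ?thesis by (simp add: d Q_def R_def)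
qed

end

section \<open>Passage to torsional rigidity and ground state energy\<close>

text \<open>Cubing removes the fractional powers: with \<open>S\<^sup>2 / E\<close> in place of
  \<open>T\<close>, the right side becomes \<open>S ^ 4 * E / R ^ 3\<close>. Monotonicity in
  \<open>T\<close> then finishes.\<close>

lemma dirichlet_quotient_bound:
  fixes S R E T d D :: real
  assumes pos: "S > 0" "R > 0" "E > 0" "d > 0" "D > 0"
    and T: "S\<^sup>2 / E \<le> T" and q: "d ^ 3 * R ^ 3 \<le> D ^ 4 * (S ^ 4 * E)"
  shows "d / D powr (4/3) \<le> T powr (2/3) * (E / R)"
proof -
  define t where "t = S\<^sup>2 / E"
  have t: "t > 0" using pos by (simp add: t_def)
  have "(t powr (2/3)) ^ 3 = t\<^sup>2" "(D powr (4/3)) ^ 3 = D ^ 4"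
    using t pos by (simp_all flip: powr_numeral add: powr_powr)
  then have "(t powr (2/3) * (E / R)) ^ 3 = S ^ 4 * E / R ^ 3"
    and "(d / D powr (4/3)) ^ 3 = d ^ 3 / D ^ 4"
    using pos by (simp_all add: power_mult_distrib power_divide t_def power_eq_if field_simps)
  moreover have "d ^ 3 / D ^ 4 \<le> S ^ 4 * E / R ^ 3"
    using pos q by (simp add: field_simps)
  ultimately have "(d / D powr (4/3)) ^ Suc 2 \<le> (t powr (2/3) * (E / R)) ^ Suc 2"
    by (simp flip: numeral_3_eq_3)
  then have "d / D powr (4/3) \<le> t powr (2/3) * (E / R)"
    by (rule power_le_imp_le_base) (use pos in simp)
  also have "\<dots> \<le> T powr (2/3) * (E / R)"
    using pos t T by (intro mult_right_mono powr_mono2) (auto simp: t_def)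
  finally show ?thesis .
qed

theorem corollary5p21:
  fixes G :: "'v wgraph" and V0 :: "'v set"
  assumes "finite_graph G"
    and "connected_graph G"
    and "\<forall>v\<in>verts G. \<forall>w\<in>verts G. eweight G v w \<in> {0, 1}"
    and "\<forall>v\<in>verts G. vweight G v = 1"
    and "\<forall>v\<in>verts G. potential G v = 0"
    and "V0 \<noteq> {}"
    and "V0 \<subset> verts G"
  shows "torsional_rigidity G V0 powr (2/3) * ground_state_energy G V0
           \<ge> Min (deg G ` (verts G - V0)) / Max (deg G ` (verts G - V0)) powr (4/3)
       \<and> ((\<exists>x y. x \<noteq> y \<and> verts G = {x, y} \<and> eweight G x y = 1 \<and> V0 = {x})
           \<longrightarrow> torsional_rigidity G V0 powr (2/3) * ground_state_energy G V0
                 = Min (deg G ` (verts G - V0)) / Max (deg G ` (verts G - V0)) powr (4/3))"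
proof -
  interpret dirichlet_graph "verts G" V0 "eweight G"
    using assms unfolding finite_graph_def connected_graph_def
    by unfold_locales auto
  let ?V = "verts G" and ?F = "test_functions G V0"
  let ?S1 = "\<lambda>u. \<Sum>v\<in>?V. \<bar>u v\<bar>" and ?S2 = "\<lambda>u. \<Sum>v\<in>?V. (u v)\<^sup>2"
  let ?d = "Min (deg G ` (?V - V0))" and ?D = "Max (deg G ` (?V - V0))"
  have deg: "deg G = degree" by (simp add: fun_eq_iff deg_def degree_def)
  have energy: "energy G u = en ?V u" for u by (simp add: energy_def en_def)
  have T: "torsional_rigidity G V0 = (SUP u\<in>?F. (?S1 u)\<^sup>2 / en ?V u)"
    using assms(4) by (simp add: torsional_rigidity_def energy)
  have \<lambda>: "ground_state_energy G V0 = (INF u\<in>?F. en ?V u / ?S2 u)"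
    using assms(4) by (simp add: ground_state_energy_def energy)
  \<comment> \<open>Replacing \<open>u\<close> by its absolute value keeps mass and norm and does
    not raise the energy, so the bounds for nonnegative functions apply.\<close>
  have en_abs: "en ?V (\<lambda>v. \<bar>u v\<bar>) \<le> en ?V u" for u
  proof -
    have "(\<bar>u v\<bar> - \<bar>u w\<bar>)\<^sup>2 \<le> (u v - u w)\<^sup>2" for v w
      by (metis abs_le_square_iff abs_triangle_ineq3)
    then show ?thesis unfolding en_def
      by (intro mult_left_mono sum_mono) (auto intro!: b_nonneg)
  qed
  have pos: "?S1 u > 0" "?S2 u > 0" "en ?V u > 0"
    and bound: "(?S1 u)\<^sup>2 / en ?V u \<le> 9/4 * card ?V ^ 3" if u: "u \<in> ?F" for u
  proof -
    obtain v where v: "v \<in> ?V" "u v \<noteq> 0" and u0: "\<And>v. v \<in> V0 \<Longrightarrow> u v = 0"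
      using u by (auto simp: test_functions_def)
    show S1: "?S1 u > 0" using v fin by (intro sum_pos2[of _ v]) auto
    show "?S2 u > 0" using v fin by (intro sum_pos2[of _ v]) auto
    have "(?S1 u)\<^sup>2 \<le> 9/4 * card ?V ^ 3 * en ?V (\<lambda>v. \<bar>u v\<bar>)"
      by (rule mass_square_le_energy) (auto simp: u0)
    also have "\<dots> \<le> 9/4 * card ?V ^ 3 * en ?V u"
      using en_abs by (intro mult_left_mono) auto
    finally have *: "(?S1 u)\<^sup>2 \<le> 9/4 * card ?V ^ 3 * en ?V u" .
    moreover have "(?S1 u)\<^sup>2 > 0" using S1 by simp
    ultimately show E: "en ?V u > 0"
      using en_nonneg[of ?V u] by (cases "en ?V u = 0") auto
    show "(?S1 u)\<^sup>2 / en ?V u \<le> 9/4 * card ?V ^ 3"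
      using * E by (simp add: divide_le_eq)
  qed
  have bdd: "bdd_above ((\<lambda>u. (?S1 u)\<^sup>2 / en ?V u) ` ?F)"
    using bound by (intro bdd_aboveI2)
  obtain a where a: "a \<in> ?V - V0" using V0_proper by blast
  then have F_ne: "(\<lambda>v. of_bool (v = a)) \<in> ?F"
    by (auto simp: test_functions_def)
  have D: "finite (deg G ` (?V - V0))" "deg G ` (?V - V0) \<noteq> {}" using fin a by auto
  have dD: "?d > 0" "?D > 0"
    using Min_in[OF D] Max_in[OF D] degree_ge_1 by (fastforce simp: deg)+
  have key: "?d / ?D powr (4/3) \<le> torsional_rigidity G V0 powr (2/3) * (en ?V u / ?S2 u)"
    if u: "u \<in> ?F" for u
  proof (rule dirichlet_quotient_bound[where S = "?S1 u"])
    show "(?S1 u)\<^sup>2 / en ?V u \<le> torsional_rigidity G V0"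
      unfolding T using bdd u by (intro cSUP_upper)
    have "?d ^ 3 * (\<Sum>v\<in>?V. \<bar>u v\<bar>\<^sup>2) ^ 3 \<le> ?D ^ 4 * (?S1 u ^ 4 * en ?V (\<lambda>v. \<bar>u v\<bar>))"
      unfolding deg using u by (intro quartic_bound) (auto simp: test_functions_def)
    also have "\<dots> \<le> ?D ^ 4 * (?S1 u ^ 4 * en ?V u)"
      using en_abs dD by (intro mult_left_mono) auto
    finally show "?d ^ 3 * ?S2 u ^ 3 \<le> ?D ^ 4 * (?S1 u ^ 4 * en ?V u)" by simp
  qed (use pos[OF u] dD in auto)
  have T_pos: "torsional_rigidity G V0 powr (2/3) > 0"
  proof -
    have "0 < ?d / ?D powr (4/3)" using dD by simp
    \<comment> \<open>A vanishing rigidity would make the right side of \<open>key\<close> zero, as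
      \<open>0 powr (2/3) = 0\<close>.\<close>
    with key[OF F_ne] show ?thesis by (cases "torsional_rigidity G V0 = 0") auto
  qed
  have ineq: "?d / ?D powr (4/3) \<le> torsional_rigidity G V0 powr (2/3) * ground_state_energy G V0"
  proof -
    \<comment> \<open>Dividing by the power of the rigidity isolates the quotient whose infimum is
      taken.\<close>
    have "?d / ?D powr (4/3) / torsional_rigidity G V0 powr (2/3) \<le> en ?V u / ?S2 u"
      if "u \<in> ?F" for u
      using pos_divide_le_eq[OF T_pos] key[OF that] by (metis mult.commute)
    then have "?d / ?D powr (4/3) / torsional_rigidity G V0 powr (2/3) \<le> ground_state_energy G V0"
      unfolding \<lambda> using F_ne by (intro cINF_greatest) auto
    then show ?thesis
      using pos_divide_le_eq[OF T_pos] by (metis mult.commute)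
  qed
  have eq: "torsional_rigidity G V0 powr (2/3) * ground_state_energy G V0 = ?d / ?D powr (4/3)"
    if xy: "x \<noteq> y" "?V = {x, y}" "eweight G x y = 1" "V0 = {x}" for x y
  proof -
    have e: "eweight G y x = 1" "eweight G x x = 0" "eweight G y y = 0"
      using xy sym[of y x] irrefl by auto
    have u: "u x = 0" "u y \<noteq> 0" if "u \<in> ?F" for u
      using that xy by (auto simp: test_functions_def)
    \<comment> \<open>Only \<open>u y\<close> is nonzero, so mass squared, energy and squared norm
      all equal \<open>(u y)\<^sup>2\<close> and both quotients are constant.\<close>
    have q: "(?S1 u)\<^sup>2 / en ?V u = 1" "en ?V u / ?S2 u = 1" if "u \<in> ?F" for u
      using u[OF that] xy e by (auto simp: en_def)
    have "(\<lambda>u. (?S1 u)\<^sup>2 / en ?V u) ` ?F = (\<lambda>u. 1) ` ?F"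
      "(\<lambda>u. en ?V u / ?S2 u) ` ?F = (\<lambda>u. 1) ` ?F"
      by (rule image_cong[OF refl q(1)], assumption) (rule image_cong[OF refl q(2)])
    moreover have "(\<lambda>u. 1) ` ?F = {1::real}" using F_ne by blast
    ultimately have "torsional_rigidity G V0 = 1" "ground_state_energy G V0 = 1"
      unfolding T \<lambda> by simp_all
    moreover have "?V - V0 = {y}" "deg G y = 1" using xy e by (auto simp: deg_def)
    ultimately show ?thesis by simp
  qed
  show ?thesis using ineq eq by blast
qed

end
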